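(* Let $n>1$. If $n$ is even, every element of $\mathrm{Sp}(n)$ can be expressed as a product of four involutions of $\mathrm{Sp}(n)$. If $n$ is odd, every element of $\mathrm{Sp}(n)$ can be expressed as a product of five involutions of $\mathrm{Sp}(n)$.
   Context: Let $\mathbb{H}$ be the real quaternions. $\mathrm{Sp}(n)=\{g\in \mathrm{GL}(n,\mathbb{H})\mid {}^{t}\bar g g=I_n\}$. An involution in a group is a non-trivial element $g$ with $g^2=1$. *)

theory Defs
  imports Complex_Main "Jordan_Normal_Form.Matrix"
begin

section \<open>The real quaternions\<close>

text \<open>\<open>Quaternion a b c d\<close> is $a + bi + cj + dk$.\<close>

datatype quaternion =
  Quaternion (q_re: real) (q_i: real) (q_j: real) (q_k: real)

lemma quaternion_eq_iff:
  "x = y \<longleftrightarrow> q_re x = q_re y \<and> q_i x = q_i y \<and> q_j x = q_j y \<and> q_k x = q_k y"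
  by (cases x; cases y) simp

definition q_cnj :: "quaternion \<Rightarrow> quaternion" where
  "q_cnj x = Quaternion (q_re x) (- q_i x) (- q_j x) (- q_k x)"

definition q_norm_sq :: "quaternion \<Rightarrow> real" where
  "q_norm_sq x = (q_re x)\<^sup>2 + (q_i x)\<^sup>2 + (q_j x)\<^sup>2 + (q_k x)\<^sup>2"

lemma q_cnj_sel [simp]:
  "q_re (q_cnj x) = q_re x" "q_i (q_cnj x) = - q_i x"
  "q_j (q_cnj x) = - q_j x" "q_k (q_cnj x) = - q_k x"
  by (simp_all add: q_cnj_def)

instantiation quaternion :: ring_1
begin

definition zero_quaternion :: quaternion where
  "0 = Quaternion 0 0 0 0"

definition one_quaternion :: quaternion where
  "1 = Quaternion 1 0 0 0"

definition plus_quaternion :: "quaternion \<Rightarrow> quaternion \<Rightarrow> quaternion" where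
  "x + y = Quaternion (q_re x + q_re y) (q_i x + q_i y) (q_j x + q_j y) (q_k x + q_k y)"

definition minus_quaternion :: "quaternion \<Rightarrow> quaternion \<Rightarrow> quaternion" where
  "x - y = Quaternion (q_re x - q_re y) (q_i x - q_i y) (q_j x - q_j y) (q_k x - q_k y)"

definition uminus_quaternion :: "quaternion \<Rightarrow> quaternion" where
  "- x = Quaternion (- q_re x) (- q_i x) (- q_j x) (- q_k x)"

definition times_quaternion :: "quaternion \<Rightarrow> quaternion \<Rightarrow> quaternion" where
  "x * y = Quaternion
     (q_re x * q_re y - q_i x * q_i y - q_j x * q_j y - q_k x * q_k y)
     (q_re x * q_i y + q_i x * q_re y + q_j x * q_k y - q_k x * q_j y)
     (q_re x * q_j y - q_i x * q_k y + q_j x * q_re y + q_k x * q_i y)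
     (q_re x * q_k y + q_i x * q_j y - q_j x * q_i y + q_k x * q_re y)"

instance
  by standard
    (simp_all add: quaternion_eq_iff zero_quaternion_def one_quaternion_def plus_quaternion_def
      minus_quaternion_def uminus_quaternion_def times_quaternion_def algebra_simps)

end

lemma quaternion_sel_simps [simp]:
  "q_re 0 = 0" "q_i 0 = 0" "q_j 0 = 0" "q_k 0 = 0"
  "q_re 1 = 1" "q_i 1 = 0" "q_j 1 = 0" "q_k 1 = 0"
  "q_re (x + y) = q_re x + q_re y" "q_i (x + y) = q_i x + q_i y"
  "q_j (x + y) = q_j x + q_j y" "q_k (x + y) = q_k x + q_k y"
  "q_re (x - y) = q_re x - q_re y" "q_i (x - y) = q_i x - q_i y"
  "q_j (x - y) = q_j x - q_j y" "q_k (x - y) = q_k x - q_k y"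
  "q_re (- x) = - q_re x" "q_i (- x) = - q_i x"
  "q_j (- x) = - q_j x" "q_k (- x) = - q_k x"
  "q_re (x * y) = q_re x * q_re y - q_i x * q_i y - q_j x * q_j y - q_k x * q_k y"
  "q_i (x * y) = q_re x * q_i y + q_i x * q_re y + q_j x * q_k y - q_k x * q_j y"
  "q_j (x * y) = q_re x * q_j y - q_i x * q_k y + q_j x * q_re y + q_k x * q_i y"
  "q_k (x * y) = q_re x * q_k y + q_i x * q_j y - q_j x * q_i y + q_k x * q_re y"
  by (simp_all add: zero_quaternion_def one_quaternion_def plus_quaternion_def
      minus_quaternion_def uminus_quaternion_def times_quaternion_def)

instantiation quaternion :: division_ring
begin

definition inverse_quaternion :: "quaternion \<Rightarrow> quaternion" where
  "inverse x = Quaternion (q_re x / q_norm_sq x) (- q_i x / q_norm_sq x)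
     (- q_j x / q_norm_sq x) (- q_k x / q_norm_sq x)"

definition divide_quaternion :: "quaternion \<Rightarrow> quaternion \<Rightarrow> quaternion" where
  "x div y = x * inverse (y :: quaternion)"

instance
proof
  fix x y :: quaternion
  show "x div y = x * inverse y" by (rule divide_quaternion_def)
  show "inverse 0 = (0 :: quaternion)"
    by (simp add: quaternion_eq_iff inverse_quaternion_def)
  assume "x \<noteq> 0"
  then have "q_norm_sq x \<noteq> 0"
    by (simp add: quaternion_eq_iff q_norm_sq_def add_nonneg_eq_0_iff)
  then show "inverse x * x = 1" "x * inverse x = 1"
    by (simp_all add: quaternion_eq_iff inverse_quaternion_def diff_divide_distrib [symmetric]
        add_divide_distrib [symmetric] mult.commute)
       (simp_all add: q_norm_sq_def power2_eq_square)
qed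

end

lemma q_cnj_simps [simp]:
  "q_cnj 0 = 0" "q_cnj 1 = 1" "q_cnj (x + y) = q_cnj x + q_cnj y"
  "q_cnj (q_cnj x) = x"
  by (simp_all add: quaternion_eq_iff)

lemma q_cnj_mult: "q_cnj (x * y) = q_cnj y * q_cnj x"
  by (simp add: quaternion_eq_iff algebra_simps)

lemma q_cnj_sum: "q_cnj (sum f A) = (\<Sum>a\<in>A. q_cnj (f a))"
  by (induction A rule: infinite_finite_induct) simp_all

section \<open>The compact symplectic group\<close>

text \<open>
  The library's \<open>mat_adjoint\<close> is not usable here: its class requires conjugation to be
  multiplicative, whereas quaternionic conjugation reverses products.
\<close>

definition q_adjoint :: "quaternion mat \<Rightarrow> quaternion mat" where
  "q_adjoint g = transpose_mat (map_mat q_cnj g)"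

definition GL_quaternion :: "nat \<Rightarrow> quaternion mat monoid" where
  "GL_quaternion n = units_of (ring_mat TYPE(quaternion) n ())"

definition Sp :: "nat \<Rightarrow> quaternion mat monoid" where
  "Sp n = (GL_quaternion n)
     \<lparr>carrier := {g \<in> carrier (GL_quaternion n). q_adjoint g * g = 1\<^sub>m n}\<rparr>"

definition involutions :: "('a, 'b) monoid_scheme \<Rightarrow> 'a set" where
  "involutions G = {g \<in> carrier G. g \<noteq> \<one>\<^bsub>G\<^esub> \<and> g [^]\<^bsub>G\<^esub> (2::nat) = \<one>\<^bsub>G\<^esub>}"

lemma q_adjoint_carrier [simp]:
  "g \<in> carrier_mat m n \<Longrightarrow> q_adjoint g \<in> carrier_mat n m"
  by (simp add: q_adjoint_def)

lemma q_adjoint_adjoint [simp]: "q_adjoint (q_adjoint g) = g"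
  by (rule eq_matI) (simp_all add: q_adjoint_def)

lemma q_adjoint_one [simp]: "q_adjoint (1\<^sub>m n) = 1\<^sub>m n"
  by (rule eq_matI) (auto simp: q_adjoint_def)

lemma q_adjoint_mult:
  assumes "g \<in> carrier_mat l m" "h \<in> carrier_mat m n"
  shows "q_adjoint (g * h) = q_adjoint h * q_adjoint g"
  using assms
  by (intro eq_matI) (auto simp: q_adjoint_def scalar_prod_def q_cnj_sum q_cnj_mult)

lemma group_GL_quaternion: "group (GL_quaternion n)"
proof -
  interpret semiring "ring_mat TYPE(quaternion) n ()" by (rule semiring_mat)
  show ?thesis unfolding GL_quaternion_def by (rule units_group)
qed

lemma GL_quaternion_simps:
  "x \<otimes>\<^bsub>GL_quaternion n\<^esub> y = x * y"
  "\<one>\<^bsub>GL_quaternion n\<^esub> = 1\<^sub>m n"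
  by (simp_all add: GL_quaternion_def units_of_def ring_mat_def)

lemma carrier_GL_quaternion:
  "carrier (GL_quaternion n) =
     {g \<in> carrier_mat n n. \<exists>h \<in> carrier_mat n n. h * g = 1\<^sub>m n \<and> g * h = 1\<^sub>m n}"
  by (simp add: GL_quaternion_def units_of_def Units_def ring_mat_def)

lemma Sp_simps:
  "x \<otimes>\<^bsub>Sp n\<^esub> y = x * y"
  "\<one>\<^bsub>Sp n\<^esub> = 1\<^sub>m n"
  by (simp_all add: Sp_def GL_quaternion_simps)

lemma carrier_Sp:
  "carrier (Sp n) = {g \<in> carrier_mat n n. q_adjoint g * g = 1\<^sub>m n \<and> g * q_adjoint g = 1\<^sub>m n}"
    (is "_ = ?R")
proof (rule subset_antisym)
  show "carrier (Sp n) \<subseteq> ?R"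
  proof
    fix g assume "g \<in> carrier (Sp n)"
    then obtain h where g: "g \<in> carrier_mat n n" "q_adjoint g * g = 1\<^sub>m n"
      and h: "h \<in> carrier_mat n n" "g * h = 1\<^sub>m n"
      by (auto simp: Sp_def carrier_GL_quaternion)
    have "q_adjoint g = q_adjoint g * (g * h)"
      using g(1) h(2) right_mult_one_mat [OF q_adjoint_carrier [OF g(1)]] by simp
    also have "\<dots> = (q_adjoint g * g) * h"
      by (rule assoc_mult_mat [symmetric, OF q_adjoint_carrier [OF g(1)] g(1) h(1)])
    also have "\<dots> = h"
      using g h by simp
    finally show "g \<in> ?R" using g h by simp
  qed
  show "?R \<subseteq> carrier (Sp n)"
    by (auto simp: Sp_def carrier_GL_quaternion)
qed

lemma group_Sp: "group (Sp n)"
proof (rule groupI)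
  fix x y assume "x \<in> carrier (Sp n)" "y \<in> carrier (Sp n)"
  then have x: "x \<in> carrier_mat n n" "q_adjoint x * x = 1\<^sub>m n"
    and y: "y \<in> carrier_mat n n" "q_adjoint y * y = 1\<^sub>m n"
    and GL: "x \<in> carrier (GL_quaternion n)" "y \<in> carrier (GL_quaternion n)"
    by (auto simp: Sp_def carrier_GL_quaternion)
  have "q_adjoint (x * y) * (x * y) = q_adjoint y * ((q_adjoint x * x) * y)"
    using x(1) y(1) by (simp add: q_adjoint_mult assoc_mult_mat [of _ n n _ n _ n])
  also have "\<dots> = 1\<^sub>m n"
    using x y by simp
  finally show "x \<otimes>\<^bsub>Sp n\<^esub> y \<in> carrier (Sp n)"
    using monoid.m_closed [OF group.is_monoid [OF group_GL_quaternion] GL]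
    by (simp add: Sp_def GL_quaternion_simps)
next
  fix x assume "x \<in> carrier (Sp n)"
  then show "\<exists>y\<in>carrier (Sp n). y \<otimes>\<^bsub>Sp n\<^esub> x = \<one>\<^bsub>Sp n\<^esub>"
    by (intro bexI [of _ "q_adjoint x"]) (auto simp: carrier_Sp Sp_simps)
qed (auto simp: Sp_simps carrier_Sp assoc_mult_mat [of _ n n _ n _ n])

end

theory Submission
  imports Defs "Jordan_Normal_Form.Spectral_Radius"
begin

text \<open>
  A quaternionic matrix has a right eigenvector, because it acts complex linearly on
  \<open>\<complex>\<^sup>2\<^sup>n\<close>; hence an element of \<open>Sp n\<close> is conjugate to \<open>p \<oplus> g'\<close> with a unit \<open>p\<close>.
  Splitting off two eigenvalues at a time reduces even \<open>n\<close> to \<open>diag p q\<close>. Let \<open>J a\<close> be the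
  antidiagonal involution with entries \<open>a\<close> and \<open>a\<^sup>*\<close>, so that \<open>J a J b = diag (a b\<^sup>*) (a\<^sup>* b)\<close>.
  Choose a unit \<open>z\<close> with \<open>Re (p z\<^sup>*) = Re (q z)\<close>. Then \<open>x = p z\<^sup>*\<close> is conjugate to the conjugate of
  \<open>y = q z\<close>, say \<open>x t = t y\<^sup>*\<close>, and \<open>diag p q = J t J (t y) J 1 J (z\<^sup>*)\<close>.

  For odd \<open>n\<close> there is \<open>v \<noteq> 0\<close> with \<open>v\<^sup>* g v\<close> real. Then some reflection \<open>s\<close> satisfies
  \<open>s g v = \<plusminus> v\<close>, so \<open>s g\<close> is conjugate to \<open>\<plusminus>1 \<oplus> h\<close> with \<open>h\<close> in \<open>Sp (n - 1)\<close>, to which the even case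
  applies.
\<close>

section \<open>Unit quaternions\<close>

lemma q_norm_sq_mult: "q_norm_sq (x * y) = q_norm_sq x * q_norm_sq y"
  by (simp add: q_norm_sq_def power2_eq_square algebra_simps)

lemma q_norm_sq_cnj [simp]: "q_norm_sq (q_cnj x) = q_norm_sq x"
  by (simp add: q_norm_sq_def)

lemma q_norm_sq_eq_0_iff [simp]: "q_norm_sq x = 0 \<longleftrightarrow> x = 0"
  by (simp add: q_norm_sq_def quaternion_eq_iff add_nonneg_eq_0_iff)

lemma q_norm_sq_nonneg [simp]: "0 \<le> q_norm_sq x"
  by (simp add: q_norm_sq_def)

lemma q_mult_cnj: "x * q_cnj x = Quaternion (q_norm_sq x) 0 0 0"
  and q_cnj_mult_self: "q_cnj x * x = Quaternion (q_norm_sq x) 0 0 0"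
  by (simp_all add: quaternion_eq_iff q_norm_sq_def power2_eq_square algebra_simps)

lemma unit_quaternion [simp]:
  assumes "q_norm_sq x = 1"
  shows "x * q_cnj x = 1" "q_cnj x * x = 1"
  using assms by (simp_all add: q_mult_cnj q_cnj_mult_self one_quaternion_def)

text \<open>Division by the norm. Here and below a real scalar is the central quaternion
  \<open>Quaternion r 0 0 0\<close>.\<close>

lemma unit_rescale:
  assumes "x \<noteq> 0"
  obtains r where "q_norm_sq (Quaternion r 0 0 0 * x) = 1" "r > 0"
proof
  have pos: "q_norm_sq x > 0"
    using assms q_norm_sq_nonneg [of x] q_norm_sq_eq_0_iff [of x] by linarith
  then show "1 / sqrt (q_norm_sq x) > 0"
    by simp
  show "q_norm_sq (Quaternion (1 / sqrt (q_norm_sq x)) 0 0 0 * x) = 1"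
    using pos assms unfolding q_norm_sq_mult
    by (simp add: q_norm_sq_def[of "Quaternion _ _ _ _"] power_divide)
qed

text \<open>Serves the degenerate case of \<open>unit_conjugator\<close>: a pure quaternion
  orthogonal to the imaginary part of \<open>u\<close> anticommutes with that part.\<close>

lemma unit_pure_orthogonal:
  obtains t where "q_norm_sq t = 1" "q_re t = 0"
    "q_i t * q_i u + q_j t * q_j u + q_k t * q_k u = 0"
proof -
  \<comment> \<open>A quarter turn of the projection of \<open>u\<close> to the plane of i and j; if
    that projection vanishes, i itself is orthogonal.\<close>
  define t0 where "t0 = (if q_i u = 0 \<and> q_j u = 0 then Quaternion 0 1 0 0
    else Quaternion 0 (- q_j u) (q_i u) 0)"
  have "t0 \<noteq> 0" "q_re t0 = 0" "q_i t0 * q_i u + q_j t0 * q_j u + q_k t0 * q_k u = 0"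
    by (auto simp: t0_def quaternion_eq_iff)
  moreover obtain r where "q_norm_sq (Quaternion r 0 0 0 * t0) = 1"
    using unit_rescale \<open>t0 \<noteq> 0\<close> by blast
  ultimately show thesis
    by (intro that [of "Quaternion r 0 0 0 * t0"])
       (simp_all add: mult.assoc flip: distrib_left)
qed

text \<open>The imaginary parts X and Y have equal length, so X + Y works: X (X + Y) and (X + Y) Y
  both equal XY - |X|^2. This fails only for Y = -X.\<close>

lemma unit_conjugator:
  assumes "q_re x = q_re y" "q_norm_sq x = q_norm_sq y"
  obtains t where "q_norm_sq t = 1" "x * t = t * y"
proof (cases "q_i x + q_i y = 0 \<and> q_j x + q_j y = 0 \<and> q_k x + q_k y = 0")
  case True
  \<comment> \<open>Now \<open>y\<close> is the conjugate of \<open>x\<close>, and any pure unit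
    orthogonal to the imaginary part of \<open>x\<close> swaps the two.\<close>
  obtain t where t: "q_norm_sq t = 1" "q_re t = 0"
    "q_i t * q_i x + q_j t * q_j x + q_k t * q_k x = 0"
    by (rule unit_pure_orthogonal)
  have y: "q_i y = - q_i x" "q_j y = - q_j x" "q_k y = - q_k x"
    using True by simp_all
  have "x * t = t * y"
    using t assms(1) by (simp add: quaternion_eq_iff y algebra_simps)
  with t show thesis by (intro that)
next
  case False
  define t0 where "t0 = Quaternion 0 (q_i x + q_i y) (q_j x + q_j y) (q_k x + q_k y)"
  have "t0 \<noteq> 0" using False by (auto simp: t0_def quaternion_eq_iff)
  then obtain r where r: "q_norm_sq (Quaternion r 0 0 0 * t0) = 1"
    using unit_rescale by blast
  have "q_i x * q_i x + q_j x * q_j x + q_k x * q_k x = q_i y * q_i y + q_j y * q_j y + q_k y * q_k y"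
    using assms by (simp add: q_norm_sq_def power2_eq_square)
  then have xt: "x * t0 = t0 * y"
    using assms(1) by (simp add: quaternion_eq_iff t0_def algebra_simps)
  have comm: "Quaternion r 0 0 0 * z = z * Quaternion r 0 0 0" for z
    by (simp add: quaternion_eq_iff)
  have "x * (Quaternion r 0 0 0 * t0) = Quaternion r 0 0 0 * t0 * y"
    using xt comm by (metis mult.assoc)
  with r show thesis by (rule that)
qed

section \<open>Block sums and products of involutions\<close>

definition block_sum :: "quaternion mat \<Rightarrow> quaternion mat \<Rightarrow> quaternion mat" where
  "block_sum A B = four_block_mat A (0\<^sub>m (dim_row A) (dim_col B)) (0\<^sub>m (dim_row B) (dim_col A)) B"

lemma block_sum_carrier [simp]:
  "A \<in> carrier_mat m k \<Longrightarrow> B \<in> carrier_mat n l \<Longrightarrow> block_sum A B \<in> carrier_mat (m + n) (k + l)"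
  by (simp add: block_sum_def)

lemma block_sum_one [simp]: "block_sum (1\<^sub>m m) (1\<^sub>m n) = 1\<^sub>m (m + n)"
  by (simp add: block_sum_def)

lemma block_sum_assoc: "block_sum A (block_sum B C) = block_sum (block_sum A B) C"
  unfolding block_sum_def by (rule assoc_four_block_mat)

lemma block_sum_mult:
  assumes "A \<in> carrier_mat m m" "A' \<in> carrier_mat m m" "B \<in> carrier_mat n n" "B' \<in> carrier_mat n n"
  shows "block_sum A B * block_sum A' B' = block_sum (A * A') (B * B')"
  using assms unfolding block_sum_def
  by (subst mult_four_block_mat [of _ m m _ n _ n _ _ m _ n]) auto

lemma q_adjoint_block_sum: "q_adjoint (block_sum A B) = block_sum (q_adjoint A) (q_adjoint B)"
  by (rule eq_matI) (auto simp: q_adjoint_def block_sum_def)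

lemma block_sum_inject:
  assumes "block_sum A B = block_sum A' B'"
    "A \<in> carrier_mat m m" "A' \<in> carrier_mat m m" "B \<in> carrier_mat n n" "B' \<in> carrier_mat n n"
  shows "A = A'" "B = B'"
proof -
  show "A = A'"
  proof (rule eq_matI)
    fix i j assume "i < dim_row A'" "j < dim_col A'"
    with assms(2-) show "A $$ (i,j) = A' $$ (i,j)"
      using arg_cong [OF assms(1), of "\<lambda>M. M $$ (i,j)"]
      by (simp add: block_sum_def index_mat_four_block carrier_matD)
  qed (use assms in auto)
  show "B = B'"
  proof (rule eq_matI)
    fix i j assume "i < dim_row B'" "j < dim_col B'"
    with assms(2-) show "B $$ (i,j) = B' $$ (i,j)"
      using arg_cong [OF assms(1), of "\<lambda>M. M $$ (m+i,m+j)"]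
      by (simp add: block_sum_def index_mat_four_block carrier_matD)
  qed (use assms in auto)
qed

text \<open>Vectors are columns and quaternions act on them from the right; as a 1 by 1 matrix a
  scalar acts by the matrix product, so associativity is that of matrices.\<close>

definition scalar :: "quaternion \<Rightarrow> quaternion mat" where
  "scalar q = mat 1 1 (\<lambda>_. q)"

lemma scalar_carrier [simp]: "scalar q \<in> carrier_mat 1 1" "scalar q \<in> carrier_mat (Suc 0) (Suc 0)"
  by (simp_all add: scalar_def)

lemma scalar_simps:
  "scalar p * scalar q = scalar (p * q)" "scalar p + scalar q = scalar (p + q)"
  "scalar p - scalar q = scalar (p - q)" "q_adjoint (scalar q) = scalar (q_cnj q)"
  "scalar p = scalar q \<longleftrightarrow> p = q"
  by (auto simp: scalar_def q_adjoint_def scalar_prod_def mat_eq_iff)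

lemma scalar_one: "scalar 1 = 1\<^sub>m 1" "scalar 1 = 1\<^sub>m (Suc 0)"
  by (auto simp: scalar_def mat_eq_iff)

text \<open>For \<open>n = 0\<close> the identity is admitted, so that induction can start at the empty matrix.\<close>

definition hermitian_roots :: "nat \<Rightarrow> quaternion mat set" where
  "hermitian_roots n =
     {a \<in> carrier_mat n n. a * a = 1\<^sub>m n \<and> q_adjoint a = a \<and> (n > 0 \<longrightarrow> a \<noteq> 1\<^sub>m n)}"

text \<open>A self-adjoint square root of the identity has its adjoint as inverse, hence lies in the
  group.\<close>

lemma hermitian_roots_involutions:
  assumes "n > 0"
  shows "hermitian_roots n \<subseteq> involutions (Sp n)"
proof
  fix a assume a: "a \<in> hermitian_roots n"
  interpret group "Sp n" by (rule group_Sp)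
  have c: "a \<in> carrier (Sp n)"
    using a by (simp add: hermitian_roots_def carrier_Sp)
  then show "a \<in> involutions (Sp n)"
    using a assms by (auto simp: involutions_def hermitian_roots_def numeral_2_eq_2 Sp_simps)
qed

text \<open>The sum differs from the identity because its first summand does, so it is
  \<open>m\<close> that has to be positive.\<close>

lemma block_sum_hermitian_roots:
  assumes "m > 0" "a \<in> hermitian_roots m" "b \<in> hermitian_roots n"
  shows "block_sum a b \<in> hermitian_roots (m + n)"
  using assms block_sum_inject(1) [of a b "1\<^sub>m m" "1\<^sub>m n" m n]
  by (auto simp: hermitian_roots_def block_sum_mult q_adjoint_block_sum)

text \<open>Here the second summand supplies the non-triviality, which allows \<open>e = 1\<close>
  in the corner.\<close>

lemma block_sum_scalar_hermitian_roots:
  assumes "n > 0" "b \<in> hermitian_roots n" "e = 1 \<or> e = -1"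
  shows "block_sum (scalar e) b \<in> hermitian_roots (Suc n)"
proof -
  have "scalar e * scalar e = 1\<^sub>m 1" "q_adjoint (scalar e) = scalar e"
    using assms(3) by (auto simp: scalar_simps scalar_one simp del: One_nat_def) (simp add: quaternion_eq_iff)
  with assms block_sum_inject(2) [of "scalar e" b "1\<^sub>m 1" "1\<^sub>m n" 1 n]
    block_sum_carrier[of "scalar e" 1 1 b n n]
  show ?thesis
    using block_sum_mult[of "scalar e" 1 "scalar e" b n b]
    by (auto simp: hermitian_roots_def q_adjoint_block_sum block_sum_one[of 1, simplified])
qed

section \<open>Antidiagonal involutions and diagonal matrices of size two\<close>

definition antidiag :: "quaternion \<Rightarrow> quaternion mat" where
  "antidiag a = mat 2 2 (\<lambda>(i,j). if i = j then 0 else if i = 0 then a else q_cnj a)"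

lemma antidiag_mult:
  "antidiag a * antidiag b = block_sum (scalar (a * q_cnj b)) (scalar (q_cnj a * b))"
  by (rule eq_matI)
     (auto simp: antidiag_def block_sum_def scalar_def scalar_prod_def less_2_cases_iff numeral_2_eq_2)

lemma antidiag_hermitian_roots:
  assumes "q_norm_sq a = 1"
  shows "antidiag a \<in> hermitian_roots 2"
proof -
  have "antidiag a * antidiag a = 1\<^sub>m 2"
    using assms block_sum_one[of 1 1] by (simp add: antidiag_mult scalar_one numeral_2_eq_2)
  moreover have "q_adjoint (antidiag a) = antidiag a"
    by (rule eq_matI) (auto simp: antidiag_def q_adjoint_def less_2_cases_iff)
  moreover have "antidiag a $$ (0,0) \<noteq> 1\<^sub>m 2 $$ (0,0)"
    by (simp add: antidiag_def)
  then have "antidiag a \<noteq> 1\<^sub>m 2"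
    by auto
  ultimately show ?thesis
    by (simp add: hermitian_roots_def) (simp add: antidiag_def)
qed

definition four_roots :: "nat \<Rightarrow> quaternion mat set" where
  "four_roots n = {g. \<exists>a\<in>hermitian_roots n. \<exists>b\<in>hermitian_roots n. \<exists>c\<in>hermitian_roots n.
     \<exists>d\<in>hermitian_roots n. g = a * b * c * d}"

lemma diag_four_roots:
  assumes "q_norm_sq p = 1" "q_norm_sq q = 1"
  shows "block_sum (scalar p) (scalar q) \<in> four_roots 2"
proof -
  obtain z where z: "q_norm_sq z = 1" "q_re (p * q_cnj z) = q_re (q * z)"
  proof -
    \<comment> \<open>Since Re(qz) is the real part of \<open>q_cnj q * q_cnj z\<close>, the
      condition says that \<open>z\<close> is orthogonal to \<open>w\<close> in four real
      dimensions. A solution is found in the span of 1 and i.\<close>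
    define w where "w = p - q_cnj q"
    define z0 where "z0 = (if q_re w = 0 \<and> q_i w = 0 then Quaternion 1 0 0 0
      else Quaternion (- q_i w) (q_re w) 0 0)"
    have "z0 \<noteq> 0" "q_re (w * q_cnj z0) = 0"
      by (auto simp: z0_def quaternion_eq_iff)
    moreover obtain r where "q_norm_sq (Quaternion r 0 0 0 * z0) = 1"
      using unit_rescale \<open>z0 \<noteq> 0\<close> by blast
    moreover have "q_re (p * q_cnj (Quaternion r 0 0 0 * z0)) - q_re (q * (Quaternion r 0 0 0 * z0))
        = r * q_re (w * q_cnj z0)"
      by (simp add: w_def algebra_simps)
    ultimately show thesis
      by (intro that [of "Quaternion r 0 0 0 * z0"]) simp_all
  qed
  define x where "x = p * q_cnj z"
  define y where "y = q * z"
  have xy: "q_norm_sq x = 1" "q_norm_sq y = 1" "q_re x = q_re y"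
    using assms z by (simp_all add: x_def y_def q_norm_sq_mult)
  obtain t where t: "q_norm_sq t = 1" "x * t = t * q_cnj y"
    using unit_conjugator [of x "q_cnj y"] xy by auto
  have 1: "t * q_cnj (t * y) = x"
    using t by (simp add: q_cnj_mult flip: mult.assoc) (simp add: mult.assoc flip: t(2))
  have 2: "q_cnj t * (t * y) = y"
    using t by (simp flip: mult.assoc)
  have 3: "x * z = p" "y * q_cnj z = q"
    using z by (simp_all add: x_def y_def mult.assoc)
  \<comment> \<open>The first pair multiplies to diag(x, y), the second to diag(z,
    \<open>q_cnj z\<close>).\<close>
  have "block_sum (scalar p) (scalar q)
      = (antidiag t * antidiag (t * y)) * (antidiag 1 * antidiag (q_cnj z))"
    unfolding antidiag_mult
    by (subst block_sum_mult [of _ 1 _ _ 1]) (simp_all add: scalar_simps 1 2 3)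
  also have "\<dots> = antidiag t * antidiag (t * y) * antidiag 1 * antidiag (q_cnj z)"
    by (rule assoc_mult_mat [symmetric, of _ 2 2 _ 2 _ 2]) (auto simp: antidiag_def)
  finally show ?thesis
    unfolding four_roots_def using t z xy
    by (auto intro!: bexI antidiag_hermitian_roots simp: q_norm_sq_mult)
       (simp add: q_norm_sq_def)
qed

section \<open>Block sums and conjugates of fourfold products\<close>

lemma block_sum_four_roots:
  assumes "m > 0" "g \<in> four_roots m" "h \<in> four_roots n"
  shows "block_sum g h \<in> four_roots (m + n)"
proof -
  obtain a b c d where g: "a \<in> hermitian_roots m" "b \<in> hermitian_roots m"
    "c \<in> hermitian_roots m" "d \<in> hermitian_roots m" "g = a * b * c * d"
    using assms by (auto simp: four_roots_def)
  obtain a' b' c' d' where h: "a' \<in> hermitian_roots n" "b' \<in> hermitian_roots n"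
    "c' \<in> hermitian_roots n" "d' \<in> hermitian_roots n" "h = a' * b' * c' * d'"
    using assms by (auto simp: four_roots_def)
  have cm: "x \<in> hermitian_roots k \<Longrightarrow> x \<in> carrier_mat k k" for x k
    by (simp add: hermitian_roots_def)
  note cs = g(1-4)[THEN cm] h(1-4)[THEN cm]
  have "block_sum g h = block_sum a a' * block_sum b b' * block_sum c c' * block_sum d d'"
    using cs unfolding g(5) h(5)
    by (subst block_sum_mult [of _ m _ _ n]; (intro mult_carrier_mat)?; simp del: assoc_mult_mat)+
  then show ?thesis
    unfolding four_roots_def using block_sum_hermitian_roots [OF \<open>m > 0\<close>] g h by blast
qed

text \<open>The first factor carries the sign \<open>e\<close> in its corner, the other three carry
  1.\<close>

lemma block_sum_sign_four_roots:
  assumes "n > 0" "h \<in> four_roots n" "e = 1 \<or> e = -1"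
  shows "block_sum (scalar e) h \<in> four_roots (Suc n)"
proof -
  obtain a b c d where h: "a \<in> hermitian_roots n" "b \<in> hermitian_roots n"
    "c \<in> hermitian_roots n" "d \<in> hermitian_roots n" "h = a * b * c * d"
    using assms by (auto simp: four_roots_def)
  have cs: "a \<in> carrier_mat n n" "b \<in> carrier_mat n n" "c \<in> carrier_mat n n" "d \<in> carrier_mat n n"
    using h by (simp_all add: hermitian_roots_def)
  have "block_sum (scalar e) h = block_sum (scalar e) a * block_sum (scalar 1) b
      * block_sum (scalar 1) c * block_sum (scalar 1) d"
    using cs
    by (simp add: h(5) block_sum_mult [of _ "Suc 0" _ _ n] mult_carrier_mat [of _ n n _ n]
        scalar_simps del: assoc_mult_mat)
  then show ?thesis
    unfolding four_roots_def using block_sum_scalar_hermitian_roots assms(1,3) h by blast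
qed

text \<open>The inverse of \<open>h\<close> is its adjoint, so conjugation by \<open>h\<close>
  preserves self-adjointness along with the square.\<close>

lemma conj_hermitian_roots:
  assumes "h \<in> carrier (Sp n)" "a \<in> hermitian_roots n"
  shows "h * a * q_adjoint h \<in> hermitian_roots n"
proof -
  have h: "h \<in> carrier_mat n n" "q_adjoint h * h = 1\<^sub>m n" "h * q_adjoint h = 1\<^sub>m n" "q_adjoint h \<in> carrier_mat n n"
    using assms(1) by (auto simp: carrier_Sp)
  have a: "a \<in> carrier_mat n n" "a * a = 1\<^sub>m n" "q_adjoint a = a" "n > 0 \<longrightarrow> a \<noteq> 1\<^sub>m n"
    using assms(2) by (auto simp: hermitian_roots_def)
  have h': "q_adjoint h * (h * x) = x" if "x \<in> carrier_mat n n" for x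
    using h that by (metis assoc_mult_mat left_mult_one_mat)
  have a': "a * (a * x) = x" if "x \<in> carrier_mat n n" for x
    using a that by (metis assoc_mult_mat left_mult_one_mat)
  have 1: "(h * a * q_adjoint h) * (h * a * q_adjoint h) = 1\<^sub>m n"
    using h a by (simp add: assoc_mult_mat [of _ n n _ n _ n] h' a')
  have 2: "q_adjoint (h * a * q_adjoint h) = h * a * q_adjoint h"
    using h a by (simp add: assoc_mult_mat [of _ n n _ n _ n] q_adjoint_mult [of _ n n _ n])
  have 3: "a = 1\<^sub>m n" if "h * a * q_adjoint h = 1\<^sub>m n"
  proof -
    have "a = q_adjoint h * (h * a * q_adjoint h) * h"
      using h a by (simp add: assoc_mult_mat [of _ n n _ n _ n] h')
    then show ?thesis using h by (simp add: that)
  qed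
  show ?thesis
    using 1 2 3 h(1,4) a(1,4) unfolding hermitian_roots_def
    by (intro CollectI conjI mult_carrier_mat [of _ n n]) (auto simp del: assoc_mult_mat)
qed

lemma conj_four_roots:
  assumes "h \<in> carrier (Sp n)" "g \<in> four_roots n"
  shows "h * g * q_adjoint h \<in> four_roots n"
proof -
  obtain a b c d where g: "a \<in> hermitian_roots n" "b \<in> hermitian_roots n"
    "c \<in> hermitian_roots n" "d \<in> hermitian_roots n" "g = a * b * c * d"
    using assms by (auto simp: four_roots_def)
  have cs: "a \<in> carrier_mat n n" "b \<in> carrier_mat n n" "c \<in> carrier_mat n n" "d \<in> carrier_mat n n"
    using g by (simp_all add: hermitian_roots_def)
  have h: "h \<in> carrier_mat n n" "q_adjoint h * h = 1\<^sub>m n" "q_adjoint h \<in> carrier_mat n n"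
    using assms(1) by (auto simp: carrier_Sp)
  have h': "q_adjoint h * (h * x) = x" if "x \<in> carrier_mat n n" for x
    using h that by (metis assoc_mult_mat left_mult_one_mat)
  have "h * g * q_adjoint h = (h * a * q_adjoint h) * (h * b * q_adjoint h)
      * (h * c * q_adjoint h) * (h * d * q_adjoint h)"
    using h cs by (simp add: g(5) assoc_mult_mat [of _ n n _ n _ n] h')
  then show ?thesis
    unfolding four_roots_def using conj_hermitian_roots [OF assms(1)] g by blast
qed

section \<open>Reflections\<close>

lemma scalar_entry: "A \<in> carrier_mat 1 1 \<Longrightarrow> A = scalar (A $$ (0,0))"
  by (rule eq_matI) (auto simp: scalar_def)

lemma q_sum_sel:
  "q_re (sum f A) = (\<Sum>a\<in>A. q_re (f a))" "q_i (sum f A) = (\<Sum>a\<in>A. q_i (f a))"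
  "q_j (sum f A) = (\<Sum>a\<in>A. q_j (f a))" "q_k (sum f A) = (\<Sum>a\<in>A. q_k (f a))"
  by (induction A rule: infinite_finite_induct) simp_all

lemma col_norm:
  assumes "x \<in> carrier_mat n 1"
  shows "q_adjoint x * x = scalar (Quaternion (\<Sum>i<n. q_norm_sq (x $$ (i,0))) 0 0 0)"
proof -
  have "q_adjoint x * x = scalar (\<Sum>i<n. q_cnj (x $$ (i,0)) * x $$ (i,0))"
    using assms by (auto intro!: eq_matI simp: q_adjoint_def scalar_def scalar_prod_def lessThan_atLeast0)
  then show ?thesis
    by (simp add: q_cnj_mult_self scalar_simps quaternion_eq_iff q_sum_sel del: quaternion_sel_simps)
qed

lemma col_norm_pos:
  assumes "x \<in> carrier_mat n 1" "x \<noteq> 0\<^sub>m n 1"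
  shows "(\<Sum>i<n. q_norm_sq (x $$ (i,0))) > 0"
proof -
  obtain i where i: "i < n" "x $$ (i,0) \<noteq> 0"
    using assms by (auto simp: mat_eq_iff)
  then have "q_norm_sq (x $$ (i,0)) > 0"
    using q_norm_sq_nonneg [of "x $$ (i,0)"] q_norm_sq_eq_0_iff [of "x $$ (i,0)"] by linarith
  then show ?thesis
    using i by (intro sum_pos2 [of _ i]) auto
qed

lemma q_adjoint_minus:
  "A \<in> carrier_mat m n \<Longrightarrow> B \<in> carrier_mat m n \<Longrightarrow> q_adjoint (A - B) = q_adjoint A - q_adjoint B"
  by (rule eq_matI) (auto simp: q_adjoint_def quaternion_eq_iff)

text \<open>The Householder reflection along \<open>w = x - y\<close>. Over the quaternions equal
  norms do not suffice: \<open>sym\<close> makes the inner product of \<open>x\<close> and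
  \<open>y\<close> real, so that \<open>x\<close> has exactly half of \<open>w\<close> as its
  component along \<open>w\<close>.\<close>

lemma reflection_exists:
  assumes x: "x \<in> carrier_mat n 1" and y: "y \<in> carrier_mat n 1"
    and norm: "q_adjoint x * x = q_adjoint y * y"
    and sym: "q_adjoint y * x = q_adjoint x * y" and "x \<noteq> y"
  obtains s where "s \<in> hermitian_roots n" "s * x = y"
proof -
  define w where "w = x - y"
  define r where "r = (\<Sum>i<n. q_norm_sq (w $$ (i,0)))"
  \<comment> \<open>The factor 2 / |w|^2 sits between \<open>w\<close> and its adjoint, so that
    \<open>P\<close> is twice the orthogonal projection onto the line of \<open>w\<close>.\<close>
  define C where "C = scalar (Quaternion (2 / r) 0 0 0)"
  define P where "P = w * C * q_adjoint w"
  have w: "w \<in> carrier_mat n 1" "q_adjoint w \<in> carrier_mat 1 n"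
    using x y by (simp_all add: w_def minus_carrier_mat del: One_nat_def)
  have "w \<noteq> 0\<^sub>m n 1"
  proof
    assume "w = 0\<^sub>m n 1"
    then have "x = y" using x y by (auto simp: w_def mat_eq_iff)
    with \<open>x \<noteq> y\<close> show False by simp
  qed
  then have r: "r > 0" using col_norm_pos [OF w(1)] by (simp add: r_def)
  have ww: "q_adjoint w * w = scalar (Quaternion r 0 0 0)"
    using col_norm [OF w(1)] by (simp add: r_def)
  have C: "C \<in> carrier_mat 1 1" by (simp add: C_def)
  \<comment> \<open>In numbers, (2/r) r (2/r) = 4/r; this yields \<open>P * P = P + P\<close>, and
    hence that \<open>1 - P\<close> squares to the identity.\<close>
  have CC: "C * (q_adjoint w * w) * C = C + C" "q_adjoint C = C"
    using r by (simp_all add: ww C_def scalar_simps) (simp_all add: quaternion_eq_iff)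
  have P: "P \<in> carrier_mat n n"
    unfolding P_def using w C by (intro mult_carrier_mat)
  define D where "D = C * q_adjoint w"
  have D: "D \<in> carrier_mat 1 n"
    unfolding D_def using C w(2) by (rule mult_carrier_mat)
  have PD: "P = w * D"
    unfolding P_def D_def using w(1) C w(2) by (rule assoc_mult_mat)
  have Dw: "D * w = C * (q_adjoint w * w)"
    unfolding D_def using C w(2,1) by (rule assoc_mult_mat)
  have X: "C * (q_adjoint w * w) \<in> carrier_mat 1 1"
    using C w by (intro mult_carrier_mat)
  have "P * P = w * (D * w * D)"
    unfolding PD using w(1) D
    by (simp add: assoc_mult_mat [of _ n 1 _ n _ n] assoc_mult_mat [of _ 1 n _ 1 _ n] mult_carrier_mat [of _ n 1 _ n]
        del: One_nat_def)
  also have "\<dots> = w * (C * (q_adjoint w * w) * C * q_adjoint w)"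
    unfolding Dw unfolding D_def using X C w(2) by (simp add: assoc_mult_mat [of _ 1 1 _ 1 _ n] del: One_nat_def)
  also have "\<dots> = w * (C * (q_adjoint w * w) * C) * q_adjoint w"
    using w X C by (intro assoc_mult_mat [symmetric] mult_carrier_mat)
  also have "\<dots> = P + P"
    unfolding CC P_def mult_add_distrib_mat [OF w(1) C C]
    using w C by (intro add_mult_distrib_mat mult_carrier_mat)
  finally have PP: "P * P = P + P" .
  define s where "s = 1\<^sub>m n - P"
  have s: "s \<in> carrier_mat n n" using P by (simp add: s_def minus_carrier_mat)
  have "s * s = 1\<^sub>m n * s - P * s"
    using minus_mult_distrib_mat [OF one_carrier_mat P s] by (simp add: s_def)
  also have "P * s = P * 1\<^sub>m n - P * P"
    unfolding s_def by (rule mult_minus_distrib_mat [OF P one_carrier_mat P])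
  also have "1\<^sub>m n * s - (P * 1\<^sub>m n - P * P) = 1\<^sub>m n - P - (P - P * P)"
    using P s by (simp add: s_def)
  also have "\<dots> = 1\<^sub>m n"
    unfolding PP using P by (auto intro!: eq_matI)
  finally have ss: "s * s = 1\<^sub>m n" .
  have "q_adjoint P = P"
    unfolding PD q_adjoint_mult [OF w(1) D] unfolding D_def q_adjoint_mult [OF C w(2)]
    using w C by (simp add: CC(2) assoc_mult_mat [OF w(1) C w(2)] del: One_nat_def)
  then have sa: "q_adjoint s = s"
    using P by (simp add: s_def q_adjoint_minus [of _ n n])
  define m where "m = (q_adjoint w * x) $$ (0,0)"
  have wx: "q_adjoint w * x = scalar m"
    unfolding m_def using w x by (intro scalar_entry) (rule mult_carrier_mat)
  have xs: "q_adjoint x \<in> carrier_mat 1 n" "q_adjoint y \<in> carrier_mat 1 n"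
    using x y by simp_all
  \<comment> \<open>Both \<open>norm\<close> and \<open>sym\<close> enter here: pairing
    \<open>w\<close> with \<open>y\<close> gives the negative of pairing \<open>w\<close> with
    \<open>x\<close>. Consequently \<open>m\<close> is r/2, \<open>P * x = w\<close> and
    \<open>s * x = x - w = y\<close>.\<close>
  have "q_adjoint w * w = q_adjoint w * x + q_adjoint w * x"
  proof -
    have 1: "q_adjoint w * x = q_adjoint x * x - q_adjoint y * x"
      using x y xs by (simp add: w_def q_adjoint_minus [of _ n 1] minus_mult_distrib_mat [of _ 1 n] del: One_nat_def)
    have 2: "q_adjoint w * y = q_adjoint y * x - q_adjoint x * x"
      using x y xs by (simp add: w_def q_adjoint_minus [of _ n 1] minus_mult_distrib_mat [of _ 1 n]
         sym norm del: One_nat_def)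
    have 3: "q_adjoint w * w = q_adjoint w * x - q_adjoint w * y"
      using w x y mult_minus_distrib_mat [of "q_adjoint w" 1 n x 1 y] by (simp add: w_def del: One_nat_def)
    have 4: "q_adjoint x * x \<in> carrier_mat 1 1" "q_adjoint y * x \<in> carrier_mat 1 1"
      using mult_carrier_mat [OF xs(1) x] mult_carrier_mat [OF xs(2) x] by simp_all
    have "A - B - (B - A) = A - B + (A - B)"
      if "A \<in> carrier_mat 1 1" "B \<in> carrier_mat 1 1" for A B :: "quaternion mat"
      using that by (intro eq_matI) auto
    from this [OF 4] show ?thesis
      unfolding 3 1 2 .
  qed
  then have "Quaternion r 0 0 0 = m + m"
    by (simp add: ww wx scalar_simps)
  then have "C * (q_adjoint w * x) = 1\<^sub>m 1"
    unfolding wx C_def scalar_simps scalar_one(1) [symmetric]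
    using r by (simp add: quaternion_eq_iff field_simps)
  then have "P * x = w"
    using w C x by (simp add: P_def assoc_mult_mat [of _ n 1 _ n _ 1] assoc_mult_mat [of _ n 1 _ 1 _ 1]
       assoc_mult_mat [of _ 1 1 _ n _ 1] assoc_mult_mat [of _ n 1 _ 1 _ n] mult_carrier_mat [of _ n 1 _ 1] del: One_nat_def)
  then have sx: "s * x = y"
    using P x y by (simp add: s_def minus_mult_distrib_mat [of _ n n _ _ 1]) (auto simp: w_def intro!: eq_matI)
  have "s \<noteq> 1\<^sub>m n" using sx x \<open>x \<noteq> y\<close> by auto
  with s ss sa sx show thesis by (intro that) (simp_all add: hermitian_roots_def)
qed

section \<open>Deflation at an eigenvector\<close>

definition first_col :: "nat \<Rightarrow> quaternion \<Rightarrow> quaternion mat" where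
  "first_col n q = mat (Suc n) 1 (\<lambda>(i,j). if i = 0 then q else 0)"

lemma first_col_carrier [simp]: "first_col n q \<in> carrier_mat (Suc n) 1"
   "first_col n q \<in> carrier_mat (Suc n) (Suc 0)"
  by (simp_all add: first_col_def)

lemma mult_first_col:
  assumes "A \<in> carrier_mat m (Suc n)"
  shows "A * first_col n q = mat m 1 (\<lambda>(i,j). A $$ (i,0) * q)"
  using assms
  by (intro eq_matI) (auto simp: first_col_def scalar_prod_def sum.atLeast0_lessThan_Suc_shift simp del: sum.op_ivl_Suc)

lemma first_col_scalar: "first_col n p * scalar q = first_col n (p * q)"
  by (rule eq_matI) (auto simp: first_col_def scalar_def scalar_prod_def)

lemma Sp_mult_closed: "g \<in> carrier (Sp n) \<Longrightarrow> h \<in> carrier (Sp n) \<Longrightarrow> g * h \<in> carrier (Sp n)"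
  using monoid.m_closed [OF group.is_monoid [OF group_Sp]] by (simp add: Sp_simps)

text \<open>The adjoint of \<open>k\<close> inverts it, so it sends the column of \<open>m\<close>
  back to the first basis vector. Thus the first column of the adjoint, and with it the first row of
  \<open>k\<close>, vanishes off the corner.\<close>

lemma Sp_block_form:
  assumes k: "k \<in> carrier (Sp (Suc n))" and eig: "k * first_col n 1 = first_col n m"
  obtains g where "g \<in> carrier (Sp n)" "q_norm_sq m = 1" "k = block_sum (scalar m) g"
proof -
  have kc: "k \<in> carrier_mat (Suc n) (Suc n)" "q_adjoint k \<in> carrier_mat (Suc n) (Suc n)"
    and ku: "q_adjoint k * k = 1\<^sub>m (Suc n)" "k * q_adjoint k = 1\<^sub>m (Suc n)"
    using k by (auto simp: carrier_Sp)
  have col: "k $$ (i,0) = (if i = 0 then m else 0)" if "i \<le> n" for i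
    using arg_cong [OF eig, of "\<lambda>M. M $$ (i,0)"] that unfolding mult_first_col [OF kc(1)]
    by (simp add: first_col_def)
  have "first_col n 1 = q_adjoint k * (k * first_col n 1)"
    using kc ku
    by (simp add: assoc_mult_mat [symmetric, of _ "Suc n" "Suc n" _ "Suc n" _ 1]
        left_mult_one_mat [of _ _ 1] del: assoc_mult_mat)
  then have e: "first_col n 1 = q_adjoint k * first_col n m"
    by (simp add: eig)
  have adj: "(q_adjoint k) $$ (i,0) * m = (if i = 0 then 1 else 0)" if "i \<le> n" for i
    using arg_cong [OF e, of "\<lambda>M. M $$ (i,0)"] that unfolding mult_first_col [OF kc(2)]
    by (simp add: first_col_def)
  have "m \<noteq> 0" using adj [of 0] by auto
  then have adj0: "(q_adjoint k) $$ (i,0) = 0" if "i \<le> n" "i \<noteq> 0" for i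
    using adj [OF that(1)] that(2) by simp
  have row: "k $$ (0,i) = 0" if "i \<le> n" "i \<noteq> 0" for i
  proof -
    have "q_cnj (k $$ (0,i)) = 0"
      using adj0 [OF that] kc that by (simp add: q_adjoint_def)
    then have "q_cnj (q_cnj (k $$ (0,i))) = q_cnj 0" by simp
    then show ?thesis by simp
  qed
  define g where "g = mat n n (\<lambda>(i,j). k $$ (Suc i, Suc j))"
  have g: "g \<in> carrier_mat n n" by (simp add: g_def)
  have kg: "k = block_sum (scalar m) g"
    using kc by (intro eq_matI) (auto simp: block_sum_def g_def scalar_def col row)
  have sc: "block_sum (1\<^sub>m 1) (1\<^sub>m n) = 1\<^sub>m (Suc n)" using block_sum_one [of 1 n] by simp
  have "block_sum (q_adjoint (scalar m) * scalar m) (q_adjoint g * g) = block_sum (1\<^sub>m 1) (1\<^sub>m n)"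
    using ku(1) g unfolding sc
    by (simp add: kg q_adjoint_block_sum block_sum_mult [of _ 1 _ _ n] scalar_simps(4))
  from block_sum_inject [OF this, of 1 n]
  have 1: "q_adjoint g * g = 1\<^sub>m n" and "q_adjoint (scalar m) * scalar m = 1\<^sub>m 1"
    using g by (auto simp: scalar_simps mult_carrier_mat [of _ n n])
  then have "q_norm_sq m = 1"
    unfolding scalar_simps scalar_one(1) [symmetric] by (simp add: q_cnj_mult_self quaternion_eq_iff)
  have "block_sum (scalar m * q_adjoint (scalar m)) (g * q_adjoint g) = block_sum (1\<^sub>m 1) (1\<^sub>m n)"
    using ku(2) g unfolding sc
    by (simp add: kg q_adjoint_block_sum block_sum_mult [of _ 1 _ _ n] scalar_simps(4))
  from block_sum_inject(2) [OF this, of 1 n] have 2: "g * q_adjoint g = 1\<^sub>m n"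
    using g by (auto simp: scalar_simps mult_carrier_mat [of _ n n])
  show thesis using 1 2 g kg \<open>q_norm_sq m = 1\<close> by (intro that) (simp_all add: carrier_Sp)
qed

text \<open>A reflection moves \<open>v\<close> to the first axis, where
  \<open>Sp_block_form\<close> applies. Right eigenvalues are determined only up to conjugacy;
  \<open>m * u = u * q\<close> records the conjugating quaternion.\<close>

lemma deflation:
  assumes g: "g \<in> carrier (Sp (Suc n))" and v: "v \<in> carrier_mat (Suc n) 1" "v \<noteq> 0\<^sub>m (Suc n) 1"
    and gv: "g * v = v * scalar q"
  obtains h m u k where "h \<in> carrier (Sp (Suc n))" "k \<in> carrier (Sp n)" "q_norm_sq m = 1" "u \<noteq> 0" "m * u = u * q"
    "g = h * block_sum (scalar m) k * q_adjoint h"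
proof -
  define r where "r = (\<Sum>i<Suc n. q_norm_sq (v $$ (i,0)))"
  have r: "r > 0" using col_norm_pos [OF v] by (simp add: r_def)
  have vv: "q_adjoint v * v = scalar (Quaternion r 0 0 0)"
    using col_norm [OF v(1)] by (simp add: r_def)
  \<comment> \<open>A real multiple of the first entry of \<open>v\<close>, scaled to the norm of
    \<open>v\<close>; if that entry is 0, a real number. The inner product of \<open>v\<close> with
    the target column is then real, as the reflection requires.\<close>
  obtain u where u: "q_norm_sq u = r" "q_cnj (v $$ (0,0)) * u = q_cnj u * v $$ (0,0)"
  proof (cases "v $$ (0,0) = 0")
    case True
    with r show thesis by (intro that [of "Quaternion (sqrt r) 0 0 0"]) (simp_all add: q_norm_sq_def)
  next
    case False
    then obtain c where c: "q_norm_sq (Quaternion c 0 0 0 * v $$ (0,0)) = 1"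
      using unit_rescale by blast
    show thesis
    proof (rule that)
      show "q_norm_sq (Quaternion (sqrt r) 0 0 0 * (Quaternion c 0 0 0 * v $$ (0,0))) = r"
        using c r by (subst q_norm_sq_mult) (simp add: q_norm_sq_def)
    qed (simp add: quaternion_eq_iff algebra_simps)
  qed
  then have "u \<noteq> 0" using r by (auto simp: q_norm_sq_def)
  define y where "y = first_col n u"
  have y: "y \<in> carrier_mat (Suc n) 1" by (simp add: y_def)
  have yy: "q_adjoint y * y = scalar (Quaternion r 0 0 0)"
    unfolding col_norm [OF y] using u(1)
    by (simp add: y_def first_col_def sum.lessThan_Suc_shift q_norm_sq_eq_0_iff [THEN iffD2] del: sum.lessThan_Suc)
  have vy: "q_adjoint v * y = scalar (q_cnj (v $$ (0,0)) * u)"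
    unfolding y_def using v by (subst mult_first_col [of _ 1]) (auto simp: scalar_def q_adjoint_def)
  have yv: "q_adjoint y * v = scalar (q_cnj u * v $$ (0,0))"
    using arg_cong [OF vy, of q_adjoint] v(1) y
    by (simp add: scalar_simps q_adjoint_mult [of _ 1 "Suc n" _ 1] q_cnj_mult)
  \<comment> \<open>If \<open>v\<close> already equals the target there is no reflection between
    them, and the identity is used.\<close>
  obtain h where h: "h \<in> carrier_mat (Suc n) (Suc n)" "h * h = 1\<^sub>m (Suc n)" "q_adjoint h = h" "h * v = y"
  proof (cases "v = y")
    case True
    with v show thesis by (intro that [of "1\<^sub>m (Suc n)"]) auto
  next
    case False
    obtain s where "s \<in> hermitian_roots (Suc n)" "s * v = y"
      by (rule reflection_exists [OF v(1) y _ _ False]) (simp_all add: vv yy vy yv u)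
    then show thesis by (intro that [of s]) (auto simp: hermitian_roots_def)
  qed
  have hS: "h \<in> carrier (Sp (Suc n))" using h by (simp add: carrier_Sp)
  define k where "k = h * g * h"
  have kS: "k \<in> carrier (Sp (Suc n))"
    unfolding k_def by (intro Sp_mult_closed g hS)
  have gc: "g \<in> carrier_mat (Suc n) (Suc n)" and kc: "k \<in> carrier_mat (Suc n) (Suc n)"
    using g kS by (auto simp: carrier_Sp)
  have hh: "h * (h * x) = x" if "x \<in> carrier_mat (Suc n) l" for x l
    using h that by (metis assoc_mult_mat left_mult_one_mat)
  have "k * y = h * (g * v)"
    unfolding k_def h(4) [symmetric] using h(1) gc v(1)
    by (simp add: assoc_mult_mat [of _ "Suc n" "Suc n" _ "Suc n" _ "Suc n"]
      assoc_mult_mat [of _ "Suc n" "Suc n" _ "Suc n" _ 1] hh [of _ 1] mult_carrier_mat [of _ "Suc n" "Suc n"] del: One_nat_def)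
  also have "\<dots> = y * scalar q"
    unfolding gv using h v(1) by (simp add: assoc_mult_mat [symmetric, of _ "Suc n" "Suc n" _ 1 _ 1] del: assoc_mult_mat One_nat_def)
  finally have ky: "k * y = first_col n (u * q)"
    by (simp add: y_def first_col_scalar)
  \<comment> \<open>The first basis vector is \<open>y\<close> times the inverse of
    \<open>u\<close>, which conjugates the eigenvalue by \<open>u\<close>.\<close>
  have "k * first_col n 1 = k * y * scalar (inverse u)"
    using kc \<open>u \<noteq> 0\<close> by (simp add: y_def first_col_scalar assoc_mult_mat [of _ "Suc n" "Suc n" _ 1 _ 1] del: One_nat_def)
  also have "\<dots> = first_col n (u * q * inverse u)"
    by (simp add: ky first_col_scalar)
  finally obtain k' where k': "k' \<in> carrier (Sp n)" "q_norm_sq (u * q * inverse u) = 1"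
    "k = block_sum (scalar (u * q * inverse u)) k'"
    using Sp_block_form [OF kS] by blast
  have "g = h * k * q_adjoint h"
    using h gc by (simp add: k_def h(3) assoc_mult_mat [of _ "Suc n" "Suc n" _ "Suc n" _ "Suc n"]
       hh [of _ "Suc n"] mult_carrier_mat [of _ "Suc n" "Suc n"])
  then show thesis
    using that [OF hS k'(1,2) \<open>u \<noteq> 0\<close>] \<open>u \<noteq> 0\<close> k'(3)
    by (simp add: mult.assoc)
qed

section \<open>Right eigenvectors\<close>

text \<open>\<open>pair_quaternion a b\<close> is \<open>a + j b\<close>, so that complex scalars on the right act on
  both components.\<close>

definition pair_quaternion :: "complex \<Rightarrow> complex \<Rightarrow> quaternion" where
  "pair_quaternion a b = Quaternion (Re a) (Im a) (Re b) (- Im b)"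

lemma pair_quaternion_sum:
  "(\<Sum>i\<in>A. pair_quaternion (f i) (g i)) = pair_quaternion (sum f A) (sum g A)"
  by (simp add: quaternion_eq_iff q_sum_sel pair_quaternion_def sum_negf)

text \<open>Follows from zj = j(\<open>cnj z\<close>) for complex z, and from j^2 = -1.\<close>

lemma pair_quaternion_mult:
  "pair_quaternion a b * pair_quaternion c d =
     pair_quaternion (a * c + (- cnj b) * d) (b * c + cnj a * d)"
  by (simp add: quaternion_eq_iff pair_quaternion_def algebra_simps)

lemma right_eigenvector:
  assumes g: "g \<in> carrier_mat n n" and "n > 0"
  obtains v q where "v \<in> carrier_mat n 1" "v \<noteq> 0\<^sub>m n 1" "g * v = v * scalar q"
proof -
  \<comment> \<open>Entrywise g = A + jB; the sign at \<open>q_k\<close> in \<open>B\<close> comes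
    from ji = -k.\<close>
  define A where "A = mat n n (\<lambda>ij. Complex (q_re (g $$ ij)) (q_i (g $$ ij)))"
  define B where "B = mat n n (\<lambda>ij. Complex (q_j (g $$ ij)) (- q_k (g $$ ij)))"
  define B' where "B' = map_mat (\<lambda>z. - cnj z) B"
  define A' where "A' = map_mat cnj A"
  \<comment> \<open>By \<open>pair_quaternion_mult\<close>, this is the action of \<open>g\<close>
    on x + jy in the complex coordinates (x, y). A complex eigenvalue of \<open>M\<close> becomes a
    right eigenvalue of \<open>g\<close>.\<close>
  define M where "M = four_block_mat A B' B A'"
  have c: "A \<in> carrier_mat n n" "B \<in> carrier_mat n n" "A' \<in> carrier_mat n n" "B' \<in> carrier_mat n n"
    by (simp_all add: A_def B_def A'_def B'_def)
  have M: "M \<in> carrier_mat (n + n) (n + n)" using c by (simp add: M_def)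
  obtain l where "l \<in> spectrum M"
    using spectrum_non_empty [OF M] \<open>n > 0\<close> by auto
  then obtain w where w: "w \<in> carrier_vec (n + n)" "w \<noteq> 0\<^sub>v (n + n)" "M *\<^sub>v w = l \<cdot>\<^sub>v w"
    using M by (auto simp: spectrum_def eigenvalue_def eigenvector_def)
  define x where "x = vec_first w n"
  define y where "y = vec_last w n"
  have xy: "x \<in> carrier_vec n" "y \<in> carrier_vec n" by (simp_all add: x_def y_def)
  have wxy: "w = x @\<^sub>v y" using w(1) by (simp add: x_def y_def)
  have "(A *\<^sub>v x + B' *\<^sub>v y) @\<^sub>v (B *\<^sub>v x + A' *\<^sub>v y) = l \<cdot>\<^sub>v (x @\<^sub>v y)"
    using w(3) four_block_mat_mult_vec [OF c(1,4,2,3) xy] by (simp add: M_def wxy)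
  also have "\<dots> = l \<cdot>\<^sub>v x @\<^sub>v l \<cdot>\<^sub>v y"
    by (rule eq_vecI) auto
  finally have e: "A *\<^sub>v x + B' *\<^sub>v y = l \<cdot>\<^sub>v x" "B *\<^sub>v x + A' *\<^sub>v y = l \<cdot>\<^sub>v y"
    using append_vec_eq [of "A *\<^sub>v x + B' *\<^sub>v y" n "l \<cdot>\<^sub>v x"] c xy by auto
  define v where "v = mat n 1 (\<lambda>(i,j). pair_quaternion (x $ i) (y $ i))"
  have gAB: "g $$ (i,j) = pair_quaternion (A $$ (i,j)) (B $$ (i,j))" if "i < n" "j < n" for i j
    using that by (simp add: A_def B_def pair_quaternion_def)
  have e1: "(\<Sum>j<n. A $$ (i,j) * x $ j + (- cnj (B $$ (i,j))) * y $ j) = l * x $ i"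
    if "i < n" for i
    using arg_cong [OF e(1), of "\<lambda>v. v $ i"] that c xy
    by (simp add: scalar_prod_def B'_def sum.distrib sum_negf sum_subtractf lessThan_atLeast0)
  have e2: "(\<Sum>j<n. B $$ (i,j) * x $ j + cnj (A $$ (i,j)) * y $ j) = l * y $ i"
    if "i < n" for i
    using arg_cong [OF e(2), of "\<lambda>v. v $ i"] that c xy
    by (simp add: scalar_prod_def A'_def sum.distrib sum_negf sum_subtractf lessThan_atLeast0)
  have "g * v = v * scalar (pair_quaternion l 0)"
  proof (rule eq_matI)
    fix i j assume "i < dim_row (v * scalar (pair_quaternion l 0))"
      "j < dim_col (v * scalar (pair_quaternion l 0))"
    then have i: "i < n" "j = 0" by (auto simp: v_def scalar_def)
    have "(g * v) $$ (i,j) = (\<Sum>k<n. g $$ (i,k) * pair_quaternion (x $ k) (y $ k))"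
      using i g by (simp add: v_def scalar_prod_def lessThan_atLeast0)
    also have "\<dots> = (\<Sum>k<n. pair_quaternion (A $$ (i,k) * x $ k + (- cnj (B $$ (i,k))) * y $ k)
        (B $$ (i,k) * x $ k + cnj (A $$ (i,k)) * y $ k))"
      using i by (intro sum.cong) (simp_all add: gAB pair_quaternion_mult)
    also have "\<dots> = pair_quaternion (l * x $ i) (l * y $ i)"
      unfolding pair_quaternion_sum e1 [OF i(1)] e2 [OF i(1)] ..
    also have "\<dots> = (v * scalar (pair_quaternion l 0)) $$ (i,j)"
      using i by (simp add: v_def scalar_def scalar_prod_def pair_quaternion_mult mult.commute)
    finally show "(g * v) $$ (i,j) = (v * scalar (pair_quaternion l 0)) $$ (i,j)" .
  qed (use g in \<open>auto simp: v_def scalar_def\<close>)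
  moreover have "v \<noteq> 0\<^sub>m n 1"
  proof
    assume v0: "v = 0\<^sub>m n 1"
    have "x $ i = 0 \<and> y $ i = 0" if "i < n" for i
      using arg_cong [OF v0, of "\<lambda>M. M $$ (i,0)"] that
      by (simp add: v_def pair_quaternion_def quaternion_eq_iff complex_eq_iff)
    then have "w = 0\<^sub>v (n + n)"
      unfolding wxy using xy by (intro eq_vecI) (auto simp: append_vec_def)
    with w(2) show False by simp
  qed
  ultimately show thesis by (intro that) (simp_all add: v_def)
qed

section \<open>Factorizations\<close>

lemma diagonalize_one:
  assumes "g \<in> carrier (Sp (Suc n))"
  obtains h p k where "h \<in> carrier (Sp (Suc n))" "k \<in> carrier (Sp n)" "q_norm_sq p = 1"
    "g = h * block_sum (scalar p) k * q_adjoint h"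
proof -
  obtain v q where "v \<in> carrier_mat (Suc n) 1" "v \<noteq> 0\<^sub>m (Suc n) 1" "g * v = v * scalar q"
    using right_eigenvector [of g "Suc n"] assms by (auto simp: carrier_Sp)
  from deflation [OF assms this] that show thesis by metis
qed

lemma block_sum_Sp:
  assumes "g \<in> carrier (Sp m)" "h \<in> carrier (Sp n)"
  shows "block_sum g h \<in> carrier (Sp (m + n))"
  using assms by (auto simp: carrier_Sp q_adjoint_block_sum block_sum_mult [of _ m _ _ n])

lemma scalar_Sp: "q_norm_sq p = 1 \<Longrightarrow> scalar p \<in> carrier (Sp 1)"
  by (simp add: carrier_Sp scalar_simps scalar_one)

text \<open>Induction in steps of two: two eigenvalues are split off, regrouped into a diagonal
  block of size two, and the remaining block is handled by the induction hypothesis.\<close>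

lemma even_four_roots:
  assumes "even n" "g \<in> carrier (Sp n)"
  shows "g \<in> four_roots n"
  using assms
proof (induction n arbitrary: g rule: less_induct)
  case (less n)
  show ?case
  proof (cases "n = 0")
    case True
    have "1\<^sub>m 0 \<in> hermitian_roots 0" by (simp add: hermitian_roots_def)
    moreover have "g = 1\<^sub>m 0 * 1\<^sub>m 0 * 1\<^sub>m 0 * 1\<^sub>m 0"
      using less.prems True by (auto simp: carrier_Sp mat_eq_iff)
    ultimately show ?thesis unfolding four_roots_def True by blast
  next
    case False
    with less.prems(1) obtain k where n: "n = Suc (Suc k)" "even k"
      by (cases n rule: nat.exhaust; cases "n - 1") auto
    obtain h p g1 where h: "h \<in> carrier (Sp n)" "g1 \<in> carrier (Sp (Suc k))" "q_norm_sq p = 1"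
      "g = h * block_sum (scalar p) g1 * q_adjoint h"
      using diagonalize_one less.prems(2) unfolding n by metis
    obtain h' q g2 where h': "h' \<in> carrier (Sp (Suc k))" "g2 \<in> carrier (Sp k)" "q_norm_sq q = 1"
      "g1 = h' * block_sum (scalar q) g2 * q_adjoint h'"
      using diagonalize_one h(2) by metis
    \<comment> \<open>Extends the second conjugation to size \<open>n\<close>; it fixes the first
      axis and so leaves \<open>p\<close> alone.\<close>
    define H where "H = block_sum (1\<^sub>m 1) h'"
    have one: "1\<^sub>m 1 \<in> carrier (Sp 1)" by (simp add: carrier_Sp)
    have H: "H \<in> carrier (Sp n)"
      using block_sum_Sp [OF one h'(1)] by (simp add: H_def n)
    have "g2 \<in> four_roots k" using less.IH [of k] n h'(2) by simp
    then have "block_sum (block_sum (scalar p) (scalar q)) g2 \<in> four_roots n"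
      using block_sum_four_roots [OF _ diag_four_roots [OF h(3) h'(3)]] by (simp add: n)
    then have "H * block_sum (scalar p) (block_sum (scalar q) g2) * q_adjoint H \<in> four_roots n"
      using conj_four_roots [OF H] by (simp add: block_sum_assoc)
    also have "H * block_sum (scalar p) (block_sum (scalar q) g2) * q_adjoint H = block_sum (scalar p) g1"
    proof -
      have c: "h' \<in> carrier_mat (Suc k) (Suc k)" "q_adjoint h' \<in> carrier_mat (Suc k) (Suc k)"
        "block_sum (scalar q) g2 \<in> carrier_mat (Suc k) (Suc k)"
        using h' block_sum_carrier [of "scalar q" 1 1 g2 k k] by (auto simp: carrier_Sp)
      have p: "1\<^sub>m 1 * scalar p * 1\<^sub>m 1 = scalar p"
        unfolding left_mult_one_mat [OF scalar_carrier(1)] by (rule right_mult_one_mat) (rule scalar_carrier)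
      have "H * block_sum (scalar p) (block_sum (scalar q) g2)
          = block_sum (1\<^sub>m 1 * scalar p) (h' * block_sum (scalar q) g2)"
        unfolding H_def using c by (intro block_sum_mult) auto
      also have "\<dots> * q_adjoint H = block_sum (1\<^sub>m 1 * scalar p * 1\<^sub>m 1)
          (h' * block_sum (scalar q) g2 * q_adjoint h')"
        unfolding H_def q_adjoint_block_sum q_adjoint_one
        using mult_carrier_mat [OF one_carrier_mat scalar_carrier(1)] mult_carrier_mat [OF c(1,3)] c
        by (intro block_sum_mult) auto
      finally show ?thesis unfolding p h'(4) .
    qed
    finally show ?thesis
      using conj_four_roots [OF h(1)] by (simp add: h(4))
  qed
qed

section \<open>The odd case\<close>

text \<open>Conjugating \<open>p\<close> by a suitable \<open>x\<close> turns its imaginary part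
  into any direction and rescales it, so it can cancel that of \<open>q\<close> with
  \<open>y = 1\<close>. If \<open>p\<close> or \<open>q\<close> is real, one term alone
  suffices.\<close>

lemma real_combination:
  obtains x y where "x \<noteq> 0 \<or> y \<noteq> 0"
    "q_cnj (q_cnj x * p * x + q_cnj y * q * y) = q_cnj x * p * x + q_cnj y * q * y"
proof -
  define P where "P = (q_i p)\<^sup>2 + (q_j p)\<^sup>2 + (q_k p)\<^sup>2"
  define Q where "Q = (q_i q)\<^sup>2 + (q_j q)\<^sup>2 + (q_k q)\<^sup>2"
  consider "P = 0" | "Q = 0" | "P > 0" "Q > 0"
    unfolding P_def Q_def by (smt (verit) zero_le_power2)
  then show thesis
  proof cases
    case 1
    then have "q_i p = 0" "q_j p = 0" "q_k p = 0" by (auto simp: P_def add_nonneg_eq_0_iff)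
    then show thesis by (intro that [of 1 0]) (simp_all add: quaternion_eq_iff)
  next
    case 2
    then have "q_i q = 0" "q_j q = 0" "q_k q = 0" by (auto simp: Q_def add_nonneg_eq_0_iff)
    then show thesis by (intro that [of 0 1]) (simp_all add: quaternion_eq_iff)
  next
    case 3
    define c where "c = sqrt (Q / P)"
    have c: "c > 0" "c\<^sup>2 * P = Q" using 3 by (simp_all add: c_def)
    define d where "d = Quaternion (sqrt c) 0 0 0"
    \<comment> \<open>The target: real part of \<open>c * p\<close>, imaginary part opposite to that
      of \<open>q\<close>. The choice of \<open>c\<close> gives both imaginary parts the same
      length, and \<open>d\<close> is the real square root of \<open>c\<close>.\<close>
    define y1 where "y1 = Quaternion (c * q_re p) (- q_i q) (- q_j q) (- q_k q)"
    have "q_norm_sq (d * d * p) = (c * q_re p)\<^sup>2 + c\<^sup>2 * P"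
      using c(1) by (simp add: d_def q_norm_sq_def P_def power_mult_distrib distrib_left)
    then have n: "q_norm_sq (d * d * p) = q_norm_sq y1"
      unfolding c(2) by (simp add: y1_def q_norm_sq_def Q_def)
    have "q_re (d * d * p) = q_re y1" using c(1) by (simp add: d_def y1_def)
    then obtain t where t: "q_norm_sq t = 1" "d * d * p * t = t * y1"
      using unit_conjugator n by blast
    have d: "z * d = d * z" "q_cnj d = d" for z by (simp_all add: d_def quaternion_eq_iff)
    have "q_cnj (d * t) * p * (d * t) = q_cnj t * (d * d * p * t)"
      by (metis d mult.assoc q_cnj_mult)
    also have "\<dots> = y1" unfolding t(2) using t(1) by (simp flip: mult.assoc)
    finally have "q_cnj (d * t) * p * (d * t) = y1" .
    then show thesis
      by (intro that [of "d * t" 1]) (simp_all add: y1_def quaternion_eq_iff)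
  qed
qed

text \<open>Splitting off one eigenvalue first kills the entries (0,1) and (1,0), so on the first
  two axes the form v^* G v has no cross terms and \<open>real_combination\<close> makes it
  real.\<close>

lemma root_times_four_roots:
  assumes "even (Suc j)" and g: "g \<in> carrier (Sp (Suc (Suc j)))"
  obtains s k where "s \<in> hermitian_roots (Suc (Suc j))" "k \<in> four_roots (Suc (Suc j))" "g = s * k"
proof -
  let ?n = "Suc (Suc j)"
  obtain h p g' where h: "h \<in> carrier (Sp ?n)" "g' \<in> carrier (Sp (Suc j))" "q_norm_sq p = 1"
      "g = h * block_sum (scalar p) g' * q_adjoint h"
    using diagonalize_one g by metis
  define G where "G = block_sum (scalar p) g'"
  have GS: "G \<in> carrier (Sp ?n)"
    using block_sum_Sp [OF scalar_Sp [OF h(3)] h(2)] by (simp add: G_def)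
  then have G: "G \<in> carrier_mat ?n ?n" "q_adjoint G * G = 1\<^sub>m ?n" "q_adjoint G \<in> carrier_mat ?n ?n"
    by (auto simp: carrier_Sp)
  have g'c: "g' \<in> carrier_mat (Suc j) (Suc j)" using h(2) by (simp add: carrier_Sp)
  obtain x y where xy: "x \<noteq> 0 \<or> y \<noteq> 0"
    "q_cnj (q_cnj x * p * x + q_cnj y * g' $$ (0,0) * y) = q_cnj x * p * x + q_cnj y * g' $$ (0,0) * y"
    by (rule real_combination)
  define v where "v = mat ?n 1 (\<lambda>(i,j). if i = 0 then x else if i = 1 then y else 0)"
  have v: "v \<in> carrier_mat ?n 1" "v \<noteq> 0\<^sub>m ?n 1"
  proof -
    have "v $$ (0,0) = x" "v $$ (1,0) = y" by (simp_all add: v_def)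
    then show "v \<noteq> 0\<^sub>m ?n 1" using xy(1) by auto
  qed (simp add: v_def)
  have Gv: "G * v \<in> carrier_mat ?n 1" using G v by simp
  have two: "(\<Sum>i<?n. f i) = f 0 + f 1" if "\<And>i. 2 \<le> i \<Longrightarrow> i < ?n \<Longrightarrow> f i = 0" for f :: "nat \<Rightarrow> quaternion"
  proof -
    have "(\<Sum>i<?n. f i) = (\<Sum>i\<in>{0,1}. f i)"
      using that by (intro sum.mono_neutral_right) auto
    then show ?thesis by simp
  qed
  have Gve: "(G * v) $$ (i,0) = G $$ (i,0) * x + G $$ (i,1) * y" if "i < ?n" for i
  proof -
    have "(G * v) $$ (i,0) = (\<Sum>k<?n. G $$ (i,k) * v $$ (k,0))"
      using G v that by (simp add: scalar_prod_def lessThan_atLeast0 del: sum.op_ivl_Suc)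
    also have "\<dots> = G $$ (i,0) * x + G $$ (i,1) * y"
      by (subst two) (auto simp: v_def)
    finally show ?thesis .
  qed
  have "(q_adjoint v * z) $$ (0,0) = (\<Sum>k<?n. q_cnj (v $$ (k,0)) * z $$ (k,0))"
    if "z \<in> carrier_mat ?n 1" for z
    using that v(1) by (simp add: scalar_prod_def q_adjoint_def lessThan_atLeast0 del: sum.op_ivl_Suc)
  from this [OF Gv] have "(q_adjoint v * (G * v)) $$ (0,0) = (\<Sum>k<?n. q_cnj (v $$ (k,0)) * (G * v) $$ (k,0))" .
  also have "\<dots> = q_cnj x * (p * x) + q_cnj y * (g' $$ (0,0) * y)"
  proof -
    have "(G * v) $$ (0,0) = p * x" "(G * v) $$ (1,0) = g' $$ (0,0) * y"
      using Gve [of 0] Gve [of 1] g'c by (simp_all add: G_def block_sum_def scalar_def del: index_mult_mat(1))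
    then show ?thesis
      by (subst two) (auto simp: v_def simp del: index_mult_mat)
  qed
  finally have vGv: "q_adjoint v * (G * v) = scalar (q_cnj x * p * x + q_cnj y * g' $$ (0,0) * y)"
    using scalar_entry [OF mult_carrier_mat [OF q_adjoint_carrier [OF v(1)] Gv]]
    by (simp only: mult.assoc)
  \<comment> \<open>The right-hand side is the adjoint of the left, and a self-conjugate scalar
    equals its adjoint.\<close>
  have sym: "q_adjoint v * (G * v) = q_adjoint (G * v) * v"
  proof -
    have "q_adjoint (q_adjoint v * (G * v)) = q_adjoint (G * v) * v"
      by (subst q_adjoint_mult [OF q_adjoint_carrier [OF v(1)] Gv]) simp
    then show ?thesis
      unfolding vGv scalar_simps xy(2) .
  qed
  have norm: "q_adjoint (G * v) * (G * v) = q_adjoint v * v"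
  proof -
    have "q_adjoint G * (G * v) = v"
      using assoc_mult_mat [OF G(3,1) v(1)] G(2) left_mult_one_mat [OF v(1)] by simp
    then show ?thesis
      unfolding q_adjoint_mult [OF G(1) v(1)] assoc_mult_mat [OF q_adjoint_carrier [OF v(1)] G(3) Gv]
      by simp
  qed
  have "\<exists>s\<in>hermitian_roots ?n. \<exists>e. (e = 1 \<or> e = -1) \<and> s * (G * v) = v * scalar e"
  proof (cases "G * v = v")
    case False
    obtain s where "s \<in> hermitian_roots ?n" "s * (G * v) = v"
      using reflection_exists [OF Gv v(1) norm sym False] .
    moreover have "v * scalar 1 = v" using v by (simp add: scalar_one)
    ultimately show ?thesis by metis
  next
    case True
    \<comment> \<open>As \<open>G\<close> fixes \<open>v\<close>, no reflection carries
      \<open>G * v\<close> to a different vector \<open>v\<close>; reflecting \<open>v\<close> to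
      \<open>-v\<close> gives the eigenvalue -1 instead.\<close>
    define w where "w = v * scalar (-1)"
    have w: "w \<in> carrier_mat ?n 1" "w = - v"
      using v by (auto simp: w_def scalar_def scalar_prod_def intro!: eq_matI)
    have "v \<noteq> w"
    proof
      assume *: "v = w"
      have "v $$ (i,0) = 0" if "i < ?n" for i
        using arg_cong [OF *, of "\<lambda>M. M $$ (i,0)"] that v(1) by (simp add: w(2) quaternion_eq_iff)
      with v show False by (auto simp: mat_eq_iff)
    qed
    obtain r where vv: "q_adjoint v * v = scalar (Quaternion r 0 0 0)"
      using col_norm [OF v(1)] by blast
    have vc: "q_adjoint v \<in> carrier_mat 1 ?n" using v by simp
    have "q_adjoint w = scalar (q_cnj (-1)) * q_adjoint v"
      unfolding w_def scalar_simps(4) [symmetric] using v(1) scalar_carrier(1) by (rule q_adjoint_mult)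
    then have aw: "q_adjoint w * z = scalar (q_cnj (-1)) * (q_adjoint v * z)" if "z \<in> carrier_mat ?n 1" for z
      using vc that by (simp add: assoc_mult_mat [of _ 1 1 _ ?n _ 1])
    have bw: "q_adjoint v * w = q_adjoint v * v * scalar (-1)"
      using vc v(1) by (simp add: w_def assoc_mult_mat [of _ 1 ?n _ 1 _ 1])
    obtain s where "s \<in> hermitian_roots ?n" "s * v = w"
    proof (rule reflection_exists [OF v(1) w(1) _ _ \<open>v \<noteq> w\<close>])
      show "q_adjoint v * v = q_adjoint w * w" "q_adjoint w * v = q_adjoint v * w"
        unfolding aw [OF v(1)] aw [OF w(1)] bw vv scalar_simps by (simp_all add: quaternion_eq_iff)
    qed
    then show ?thesis using True w_def by metis
  qed
  then obtain s e where s: "s \<in> hermitian_roots ?n" "e = 1 \<or> e = -1" "s * (G * v) = v * scalar e"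
    by blast
  have sc: "s \<in> carrier_mat ?n ?n" "s * s = 1\<^sub>m ?n" "s \<in> carrier (Sp ?n)"
    using s(1) by (auto simp: hermitian_roots_def carrier_Sp)
  define K where "K = s * G"
  have KS: "K \<in> carrier (Sp ?n)" unfolding K_def by (intro Sp_mult_closed sc GS)
  have Kv: "K * v = v * scalar e"
    using s(3) sc G v by (simp add: K_def assoc_mult_mat [of _ ?n ?n _ ?n _ 1] del: One_nat_def)
  obtain h2 m u k where h2: "h2 \<in> carrier (Sp ?n)" "k \<in> carrier (Sp (Suc j))" "u \<noteq> 0" "m * u = u * e"
    "K = h2 * block_sum (scalar m) k * q_adjoint h2"
    using deflation [OF KS v Kv] by metis
  \<comment> \<open>The sign \<open>e\<close> is central, so the conjugate eigenvalue
    \<open>m\<close> is \<open>e\<close> itself.\<close>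
  have "m * u = e * u" using h2(4) s(2) by auto
  then have "m = e" using h2(3) by (metis mult_right_cancel)
  have "K \<in> four_roots ?n"
    unfolding h2(5) \<open>m = e\<close>
    by (intro conj_four_roots h2 block_sum_sign_four_roots even_four_roots assms s) simp
  have "h * K * q_adjoint h \<in> four_roots ?n"
    using conj_four_roots [OF h(1) \<open>K \<in> four_roots ?n\<close>] .
  moreover have "h * s * q_adjoint h \<in> hermitian_roots ?n"
    using conj_hermitian_roots [OF h(1) s(1)] .
  \<comment> \<open>Since \<open>s\<close> is its own inverse, \<open>G = s * K\<close>; conjugation
    by \<open>h\<close> brings this back to \<open>g\<close>.\<close>
  moreover have "g = (h * s * q_adjoint h) * (h * K * q_adjoint h)"
  proof -
    have hc: "h \<in> carrier_mat ?n ?n" "q_adjoint h \<in> carrier_mat ?n ?n" "q_adjoint h * h = 1\<^sub>m ?n"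
      using h(1) by (auto simp: carrier_Sp)
    have 1: "q_adjoint h * (h * z) = z" "s * (s * z) = z" if "z \<in> carrier_mat ?n ?n" for z
      using hc sc that by (metis assoc_mult_mat left_mult_one_mat)+
    show ?thesis
      unfolding h(4) G_def [symmetric] K_def using hc sc G
      by (simp add: assoc_mult_mat [of _ ?n ?n _ ?n _ ?n] mult_carrier_mat [of _ ?n ?n _ ?n] 1)
  qed
  ultimately show thesis using that by blast
qed

theorem corollary1p3:
  fixes n :: nat
  assumes "n > 1"
  shows "(even n \<longrightarrow> (\<forall>g \<in> carrier (Sp n).
            \<exists>a \<in> involutions (Sp n). \<exists>b \<in> involutions (Sp n). \<exists>c \<in> involutions (Sp n).
            \<exists>d \<in> involutions (Sp n).
              g = a \<otimes>\<^bsub>Sp n\<^esub> b \<otimes>\<^bsub>Sp n\<^esub> c \<otimes>\<^bsub>Sp n\<^esub> d)) \<and>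
         (odd n \<longrightarrow> (\<forall>g \<in> carrier (Sp n).
            \<exists>a \<in> involutions (Sp n). \<exists>b \<in> involutions (Sp n). \<exists>c \<in> involutions (Sp n).
            \<exists>d \<in> involutions (Sp n). \<exists>e \<in> involutions (Sp n).
              g = a \<otimes>\<^bsub>Sp n\<^esub> b \<otimes>\<^bsub>Sp n\<^esub> c \<otimes>\<^bsub>Sp n\<^esub> d \<otimes>\<^bsub>Sp n\<^esub> e))"
proof (intro conjI impI ballI)
  have inv: "a \<in> involutions (Sp n)" if "a \<in> hermitian_roots n" for a
    using subsetD [OF hermitian_roots_involutions that] assms by simp
  fix g assume g: "g \<in> carrier (Sp n)"
  show "\<exists>a \<in> involutions (Sp n). \<exists>b \<in> involutions (Sp n). \<exists>c \<in> involutions (Sp n).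
      \<exists>d \<in> involutions (Sp n). g = a \<otimes>\<^bsub>Sp n\<^esub> b \<otimes>\<^bsub>Sp n\<^esub> c \<otimes>\<^bsub>Sp n\<^esub> d" if "even n"
    using even_four_roots [OF that g] inv unfolding four_roots_def Sp_simps by blast
  assume "odd n"
  \<comment> \<open>An odd \<open>n > 1\<close> is at least 3, so the block of size
    \<open>n - 1\<close> is even and non-empty.\<close>
  with assms obtain j where j: "n = Suc (Suc j)" "even (Suc j)"
    by (metis even_Suc less_imp_Suc_add One_nat_def add_Suc plus_nat.add_0)
  obtain s k where sk: "s \<in> hermitian_roots n" "k \<in> four_roots n" "g = s * k"
    using root_times_four_roots j g by metis
  then obtain a b c d where k: "a \<in> hermitian_roots n" "b \<in> hermitian_roots n"
    "c \<in> hermitian_roots n" "d \<in> hermitian_roots n" "k = a * b * c * d"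
    by (auto simp: four_roots_def)
  have "s \<in> carrier_mat n n" "a \<in> carrier_mat n n" "b \<in> carrier_mat n n" "c \<in> carrier_mat n n"
    "d \<in> carrier_mat n n"
    using sk k by (simp_all add: hermitian_roots_def)
  then have "g = s * a * b * c * d"
    unfolding sk(3) k(5) by (simp add: assoc_mult_mat [of _ n n _ n _ n] mult_carrier_mat [of _ n n])
  with inv [OF sk(1)] k(1-4) [THEN inv]
  show "\<exists>a \<in> involutions (Sp n). \<exists>b \<in> involutions (Sp n). \<exists>c \<in> involutions (Sp n).
      \<exists>d \<in> involutions (Sp n). \<exists>e \<in> involutions (Sp n).
        g = a \<otimes>\<^bsub>Sp n\<^esub> b \<otimes>\<^bsub>Sp n\<^esub> c \<otimes>\<^bsub>Sp n\<^esub> d \<otimes>\<^bsub>Sp n\<^esub> e"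
    unfolding Sp_simps by blast
qed

end
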